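(* Let $X\subset S^{n-1}\subset\mathbb{R}^n$ be a finite nonempty set that is a spherical $t$-design and an $s$-distance set. Assume that $X$ is antipodal and that $t\ge 2s-3$. Then $X$, together with the relations determined by the inner products between its points, has the structure of an association scheme of class $s$. That is, writing $\{\boldsymbol x\cdot\boldsymbol y \mid \boldsymbol x,\boldsymbol y\in X,\ \boldsymbol x\ne\boldsymbol y\}=\{\alpha_1,\dots,\alpha_s\}$, $\alpha_0=1$ and $R_i=\{(\boldsymbol x,\boldsymbol y)\in X\times X\mid \boldsymbol x\cdot\boldsymbol y=\alpha_i\}$ for $0\le i\le s$, the pair $(X,\{R_i\}_{0\le i\le s})$ is a (symmetric) association scheme of class $s$.
   Context: $S^{n-1}$ is the unit sphere in $\mathbb{R}^n$ and $\boldsymbol x\cdot\boldsymbol y$ is the standard inner product. A finite nonempty subset $X\subset S^{n-1}$ is a spherical $t$-design if $\frac{1}{|X|}\sum_{\boldsymbol x\in X}f(\boldsymbol x)=\frac{1}{|S^{n-1}|}\int_{S^{n-1}}f\,d\sigma$ for every real polynomial $f$ in $n$ variables of degree at most $t$. $X$ is an $s$-distance set (has degree $s$) if exactly $s$ distinct values occur as $\boldsymbol x\cdot\boldsymbol y$ with $\boldsymbol x\neq\boldsymbol y$ in $X$. $X$ is antipodal if $\boldsymbol x\in X$ implies $-\boldsymbol x\in X$. A symmetric association scheme of class $s$ on a finite set $X$ is a partition of $X\times X$ into nonempty symmetric relations $R_0,\dots,R_s$, with $R_0$ the diagonal, such that for all $0\le i,j,k\le s$ the number $|\{z\in X\mid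 (x,z)\in R_i,\ (z,y)\in R_j\}|$ is the same for all $(x,y)\in R_k$; this number is denoted $p_{i,j}^k$. *)

theory Defs
  imports "HOL-Analysis.Analysis" "HOL-Library.Poly_Mapping"
begin

text \<open>
  The surface measure on the unit sphere, given by polar coordinates: the measure of a Borel set
  \<open>A\<close> of unit vectors is \<open>n\<close> times the volume of the solid cone \<open>{r *\<^sub>R x | r x. 0 < r \<le> 1 \<and> x \<in> A}\<close>,
  where \<open>n\<close> is the dimension. On nonzero vectors, \<open>sgn\<close> is the radial projection
  \<open>x \<mapsto> x /\<^sub>R norm x\<close>. In dimension one this is the counting measure on the two unit vectors.
\<close>

definition sphere_measure :: "'a::euclidean_space measure" where
  "sphere_measure =
     scale_measure (ennreal (real DIM('a)))
       (distr (restrict_space lborel (cball 0 1 - {0})) (restrict_space borel (sphere 0 1)) sgn)"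

lemma space_sphere_measure: "space (sphere_measure :: 'a::euclidean_space measure) = sphere 0 1"
  by (simp add: sphere_measure_def space_scale_measure space_restrict_space)

lemma sets_sphere_measure:
  "sets (sphere_measure :: 'a::euclidean_space measure) = sets (restrict_space borel (sphere 0 1))"
  by (simp add: sphere_measure_def)

lemma measurable_sgn_sphere:
  "sgn \<in> restrict_space lborel (cball 0 1 - {0 :: 'a::euclidean_space})
           \<rightarrow>\<^sub>M restrict_space borel (sphere 0 1)"
proof (rule measurable_restrict_space2)
  show "sgn \<in> space (restrict_space lborel (cball 0 1 - {0 :: 'a})) \<rightarrow> sphere 0 1"
    by (auto simp: space_restrict_space norm_sgn)
  have "(\<lambda>x::'a. x /\<^sub>R norm x) \<in> borel_measurable (restrict_space lborel (cball 0 1 - {0}))"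
    by (rule measurable_restrict_space1) simp
  thus "sgn \<in> borel_measurable (restrict_space lborel (cball 0 1 - {0 :: 'a}))"
    by (simp add: sgn_div_norm[abs_def])
qed

lemma emeasure_sphere_measure:
  assumes "A \<in> sets borel" "A \<subseteq> sphere 0 1"
  shows "emeasure (sphere_measure :: 'a::euclidean_space measure) A =
           ennreal (real DIM('a)) * emeasure lborel {r *\<^sub>R x | r x. 0 < r \<and> r \<le> 1 \<and> x \<in> A}"
proof -
  have eq: "sgn -` A \<inter> (cball 0 1 - {0}) = {r *\<^sub>R x | r x. 0 < r \<and> r \<le> 1 \<and> x \<in> A}"
  proof (intro equalityI subsetI)
    fix y assume "y \<in> sgn -` A \<inter> (cball 0 1 - {0})"
    hence "y = norm y *\<^sub>R sgn y" "0 < norm y" "norm y \<le> 1" "sgn y \<in> A"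
      by (auto simp: sgn_div_norm)
    thus "y \<in> {r *\<^sub>R x | r x. 0 < r \<and> r \<le> 1 \<and> x \<in> A}" by blast
  next
    fix y assume "y \<in> {r *\<^sub>R x | r x. 0 < r \<and> r \<le> 1 \<and> x \<in> A}"
    then obtain r x where y: "y = r *\<^sub>R x" "0 < r" "r \<le> 1" "x \<in> A" by blast
    with assms have "norm x = 1" by auto
    with y show "y \<in> sgn -` A \<inter> (cball 0 1 - {0})"
      by (auto simp: sgn_div_norm)
  qed
  have A: "A \<in> sets (restrict_space borel (sphere 0 1))"
    using assms by (simp add: sets_restrict_space_iff)
  have "emeasure (distr (restrict_space lborel (cball 0 1 - {0 :: 'a}))
           (restrict_space borel (sphere 0 1)) sgn) A =
        emeasure lborel (sgn -` A \<inter> (cball 0 1 - {0}))"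
    by (subst emeasure_distr[OF measurable_sgn_sphere A])
       (auto simp: space_restrict_space emeasure_restrict_space)
  thus ?thesis by (simp add: sphere_measure_def eq)
qed

lemma emeasure_sphere_measure_sphere:
  "emeasure (sphere_measure :: 'a::euclidean_space measure) (sphere 0 1) =
     ennreal (real DIM('a) * unit_ball_vol (real DIM('a)))"
proof -
  have "emeasure lborel (cball (0::'a) 1 - {0}) = emeasure lborel (cball (0::'a) 1)"
    by (subst emeasure_Diff) auto
  moreover have "{r *\<^sub>R x | r x. 0 < r \<and> r \<le> 1 \<and> x \<in> sphere (0::'a) 1} = cball 0 1 - {0}"
  proof (intro equalityI subsetI)
    fix y::'a assume "y \<in> cball 0 1 - {0}"
    hence "y = norm y *\<^sub>R sgn y" "0 < norm y" "norm y \<le> 1" "sgn y \<in> sphere 0 1"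
      by (auto simp: sgn_div_norm)
    thus "y \<in> {r *\<^sub>R x | r x. 0 < r \<and> r \<le> 1 \<and> x \<in> sphere (0::'a) 1}" by blast
  qed auto
  moreover have "emeasure lborel (cball (0::'a) 1) = ennreal (unit_ball_vol (real DIM('a)))"
    using emeasure_cball[of 1 "0::'a"] by simp
  ultimately show ?thesis by (subst emeasure_sphere_measure) (auto simp: ennreal_mult)
qed

text \<open>
  Formal real polynomials in variables indexed by \<open>'n\<close> are finitely supported maps from exponent
  vectors to coefficients.
\<close>

type_synonym 'n real_mpoly = "('n \<Rightarrow>\<^sub>0 nat) \<Rightarrow>\<^sub>0 real"

definition mpoly_eval :: "('n::finite) real_mpoly \<Rightarrow> real ^ 'n \<Rightarrow> real" where
  "mpoly_eval p x = (\<Sum>m\<in>Poly_Mapping.keys p. Poly_Mapping.lookup p m * (\<Prod>i\<in>UNIV. (x $ i) ^ Poly_Mapping.lookup m i))"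

text \<open>The zero polynomial has degree at most \<open>t\<close> for every \<open>t\<close>.\<close>

definition mpoly_degree_le :: "('n::finite) real_mpoly \<Rightarrow> nat \<Rightarrow> bool" where
  "mpoly_degree_le p t \<longleftrightarrow> (\<forall>m\<in>Poly_Mapping.keys p. (\<Sum>i\<in>UNIV. Poly_Mapping.lookup m i) \<le> t)"

definition spherical_design :: "nat \<Rightarrow> (real ^ 'n::finite) set \<Rightarrow> bool" where
  "spherical_design t X \<longleftrightarrow>
     finite X \<and> X \<noteq> {} \<and> X \<subseteq> sphere 0 1 \<and>
     (\<forall>p. mpoly_degree_le p t \<longrightarrow>
        (\<Sum>x\<in>X. mpoly_eval p x) / real (card X) =
        (LINT x|sphere_measure. mpoly_eval p x) / measure sphere_measure (sphere (0 :: real ^ 'n) 1))"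

definition inner_products :: "('a::real_inner) set \<Rightarrow> real set" where
  "inner_products X = {x \<bullet> y | x y. x \<in> X \<and> y \<in> X \<and> x \<noteq> y}"

definition distance_set :: "nat \<Rightarrow> ('a::real_inner) set \<Rightarrow> bool" where
  "distance_set s X \<longleftrightarrow> finite (inner_products X) \<and> card (inner_products X) = s"

definition antipodal :: "('a::real_inner) set \<Rightarrow> bool" where
  "antipodal X \<longleftrightarrow> (\<forall>x\<in>X. - x \<in> X)"

definition symmetric_association_scheme :: "nat \<Rightarrow> 'a set \<Rightarrow> (nat \<Rightarrow> ('a \<times> 'a) set) \<Rightarrow> bool" where
  "symmetric_association_scheme s X R \<longleftrightarrow>
     finite X \<and>
     (\<Union>i\<in>{0..s}. R i) = X \<times> X \<and>
     disjoint_family_on R {0..s} \<and>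
     (\<forall>i\<in>{0..s}. R i \<noteq> {} \<and> sym (R i)) \<and>
     R 0 = Id_on X \<and>
     (\<forall>i\<in>{0..s}. \<forall>j\<in>{0..s}. \<forall>k\<in>{0..s}. \<exists>p::nat. \<forall>(x, y)\<in>R k.
        card {z \<in> X. (x, z) \<in> R i \<and> (z, y) \<in> R j} = p)"

end

theory Submission
  imports Defs
begin

text \<open>
  Two inner products are settled by antipodality. If \<open>u = 1\<close> or \<open>u = -1\<close>, the only unit vector
  \<open>z\<close> with \<open>x \<bullet> z = u\<close> is \<open>x\<close> or \<open>- x\<close>, both of which lie in the antipodal set \<open>X\<close>, so the
  intersection numbers with such an index can be read off from \<open>x \<bullet> y\<close>. Since \<open>-1\<close> is itself one of
  the \<open>s\<close> inner products, only a set \<open>A\<close> of \<open>s - 1\<close> interior values remains.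

  For \<open>u\<close> and \<open>v\<close> in \<open>A\<close>, the polynomial
  \<open>h x y z = (\<Prod>b\<in>A - {u}. x \<bullet> z - b) * (\<Prod>c\<in>A - {v}. y \<bullet> z - c)\<close> in \<open>z\<close> has degree at most
  \<open>2 * (s - 2)\<close>, within the strength of the design. On points of \<open>X\<close> other than
  \<open>x, - x, y, - y\<close> it vanishes unless \<open>x \<bullet> z = u\<close> and \<open>y \<bullet> z = v\<close>, where it takes a fixed
  nonzero value. Hence the sum of \<open>h x y\<close> over \<open>X\<close> is a nonzero constant times the number of such \<open>z\<close>,
  plus the contribution of the four exceptional points.

  If \<open>x \<bullet> y = x' \<bullet> y'\<close>, some orthogonal map \<open>f\<close> takes \<open>x, y\<close> to \<open>x', y'\<close>
  (\<open>orthogonal_transformation_pair_exists\<close>). It need not preserve \<open>X\<close>, but the design property turns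
  the sum over \<open>X\<close> into an integral over the sphere, which \<open>f\<close> does preserve
  (\<open>spherical_design_zonal_sum\<close>), and it carries the exceptional points of \<open>x, y\<close> to those of
  \<open>x', y'\<close>. So the number of \<open>z\<close> is the same for both pairs
  (\<open>card_inner_interior_orthogonal\<close>).
\<close>

section \<open>Orthogonal invariance of Lebesgue measure and of the surface measure\<close>

text \<open>
  An orthogonal map sends balls to balls of the same radius. By the Vitali covering theorem an open
  set is, up to a null set, a countable disjoint union of balls, so its measure is preserved.
\<close>

lemma emeasure_lborel_orthogonal_image_open:
  fixes f :: "'a::euclidean_space \<Rightarrow> 'a"
  assumes f: "orthogonal_transformation f" and U: "open U"
  shows "emeasure lborel (f ` U) = emeasure lborel U"
proof -
  let ?b = "\<lambda>i::'a \<times> real. ball (fst i) (snd i)"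
  obtain C where C: "countable C" "C \<subseteq> {i. ?b i \<subseteq> U \<and> 0 < snd i}"
    and disj: "pairwise (\<lambda>i j. disjnt (?b i) (?b j)) C"
    and neg: "negligible (U - (\<Union>i\<in>C. ?b i))"
  proof (rule Vitali_covering_theorem_balls[of U "{i. ?b i \<subseteq> U \<and> 0 < snd i}" fst snd])
    fix x and d :: real assume x: "x \<in> U" "0 < d"
    from U x(1) obtain e where e: "0 < e" "ball x e \<subseteq> U" by (auto elim: openE)
    have "ball x (min e (d / 2)) \<subseteq> U" using e(2) by auto
    thus "\<exists>i. i \<in> {i. ?b i \<subseteq> U \<and> 0 < snd i} \<and> x \<in> ?b i \<and> snd i < d"
      using e(1) x(2) by (intro exI[of _ "(x, min e (d / 2))"]) auto
  qed auto
  define B where "B = (\<Union>i\<in>C. ?b i)"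
  have BU: "B \<subseteq> U" using C(2) by (auto simp: B_def)
  have inj: "inj f" using f by (rule orthogonal_transformation_inj)
  have fball: "f ` ?b i = ball (f (fst i)) (snd i)" for i
    using f by (rule image_orthogonal_transformation_ball)
  have opB: "open B" unfolding B_def by auto
  have fB: "f ` B = (\<Union>i\<in>C. f ` ?b i)" unfolding B_def by auto
  have op: "open (f ` B)" unfolding fB fball by auto
  have opU: "open (f ` U)"
    using f U by (simp add: open_surjective_linear_image orthogonal_transformation_linear orthogonal_transformation_surj)
  have "negligible (f ` (U - B))"
    by (rule negligible_differentiable_image_negligible)
       (use neg f in \<open>auto simp: B_def intro!: linear_imp_differentiable_on orthogonal_transformation_linear\<close>)
  moreover have "f ` (U - B) = f ` U - f ` B" by (simp add: image_set_diff inj)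
  ultimately have null: "f ` U - f ` B \<in> null_sets lborel" 
    using op opU by (simp add: negligible_iff_null_sets null_sets_completion_iff)
  have null': "U - B \<in> null_sets lborel"
    using neg opB U by (simp add: B_def[symmetric] negligible_iff_null_sets null_sets_completion_iff)
  have "emeasure lborel (f ` U) = emeasure lborel (f ` B)"
    using emeasure_Un_null_set[OF _ null, of "f ` B"] op BU by (simp add: Un_absorb1 image_mono)
  also have "\<dots> = (\<integral>\<^sup>+i. emeasure lborel (f ` ?b i) \<partial>count_space C)"
    unfolding fB
  proof (rule emeasure_UN_countable)
    show "disjoint_family_on (\<lambda>i. f ` ?b i) C"
      using disj by (auto simp: disjoint_family_on_def pairwise_def disjnt_def image_Int[OF inj, symmetric])
  qed (use C(1) in \<open>auto simp: fball\<close>)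
  also have "\<dots> = (\<integral>\<^sup>+i. emeasure lborel (?b i) \<partial>count_space C)"
    using C(2) by (intro nn_integral_cong) (auto simp: fball emeasure_ball)
  also have "\<dots> = emeasure lborel B"
    unfolding B_def
  proof (rule emeasure_UN_countable[symmetric])
    show "disjoint_family_on ?b C"
      using disj by (auto simp: disjoint_family_on_def pairwise_def disjnt_def)
  qed (use C(1) in auto)
  also have "\<dots> = emeasure lborel U"
    using emeasure_Un_null_set[OF _ null', of B] opB BU by (simp add: Un_absorb1)
  finally show ?thesis .
qed

lemma borel_measurable_orthogonal:
  fixes f :: "'a::euclidean_space \<Rightarrow> 'a"
  assumes "orthogonal_transformation f"
  shows "f \<in> borel_measurable borel"
  by (intro borel_measurable_continuous_onI linear_continuous_on)
     (use assms in \<open>auto simp: linear_linear orthogonal_transformation_linear\<close>)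

lemma distr_lborel_orthogonal:
  fixes f :: "'a::euclidean_space \<Rightarrow> 'a"
  assumes f: "orthogonal_transformation f"
  shows "distr lborel borel f = lborel"
proof (rule lborel_eqI[symmetric])
  fix l u :: 'a assume le: "\<And>b. b \<in> Basis \<Longrightarrow> l \<bullet> b \<le> u \<bullet> b"
  have "emeasure (distr lborel borel f) (box l u) = emeasure lborel (f -` box l u)"
    using borel_measurable_orthogonal[OF f] by (subst emeasure_distr) auto
  also have "\<dots> = emeasure lborel (inv f ` box l u)"
    using f by (simp add: bij_vimage_eq_inv_image orthogonal_transformation_bij)
  also have "\<dots> = emeasure lborel (box l u)"
    using f by (intro emeasure_lborel_orthogonal_image_open orthogonal_transformation_inv) auto
  finally show "emeasure (distr lborel borel f) (box l u) = (\<Prod>b\<in>Basis. (u - l) \<bullet> b)"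
    using le by simp
qed auto

lemma measurable_orthogonal_sphere_measure:
  fixes f :: "'a::euclidean_space \<Rightarrow> 'a"
  assumes f: "orthogonal_transformation f"
  shows "f \<in> sphere_measure \<rightarrow>\<^sub>M sphere_measure"
proof -
  have "f \<in> restrict_space borel (sphere 0 1) \<rightarrow>\<^sub>M restrict_space borel (sphere 0 1)"
    using borel_measurable_orthogonal[OF f] f
    by (intro measurable_restrict_space2 measurable_restrict_space1)
       (auto simp: space_restrict_space orthogonal_transformation_norm)
  thus ?thesis by (subst measurable_cong_sets[OF sets_sphere_measure sets_sphere_measure])
qed

text \<open>
  The surface measure of a set is a multiple of the volume of the cone over it, and an orthogonal map
  commutes with radial projection, so it takes cones to cones.
\<close>

lemma distr_sphere_measure_orthogonal:
  fixes f :: "'a::euclidean_space \<Rightarrow> 'a"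
  assumes f: "orthogonal_transformation f"
  shows "distr sphere_measure sphere_measure f = sphere_measure"
proof (rule measure_eqI)
  let ?K = "cball 0 1 - {0::'a}"
  let ?S = "sphere (0::'a) 1"
  have em: "emeasure sphere_measure A = ennreal (real DIM('a)) * emeasure lborel (sgn -` A \<inter> ?K)"
    if A: "A \<in> sets (sphere_measure :: 'a measure)" for A
  proof -
    have "emeasure (distr (restrict_space lborel ?K) (restrict_space borel ?S) sgn) A =
          emeasure lborel (sgn -` A \<inter> ?K)"
      using A by (subst emeasure_distr[OF measurable_sgn_sphere])
        (auto simp: sets_sphere_measure space_restrict_space emeasure_restrict_space)
    thus ?thesis by (simp add: sphere_measure_def)
  qed
  fix A :: "'a set" assume "A \<in> sets (distr sphere_measure sphere_measure f)"
  hence A: "A \<in> sets (sphere_measure :: 'a measure)" by simp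
  note meas = measurable_orthogonal_sphere_measure[OF f]
  have cone: "sgn -` A \<inter> ?K \<in> sets lborel"
    using measurable_sets[OF measurable_sgn_sphere, of A] A
    by (simp add: sets_sphere_measure space_restrict_space sets_restrict_space_iff)
  have fsgn: "f (sgn x) = sgn (f x)" for x
    using f by (simp add: sgn_div_norm orthogonal_transformation_scaleR orthogonal_transformation_norm)
  have f0: "f x = 0 \<longleftrightarrow> x = 0" for x
    using orthogonal_transformation_norm[OF f, of x] by (metis norm_eq_zero)
  have "emeasure (distr sphere_measure sphere_measure f) A = emeasure sphere_measure (f -` A \<inter> ?S)"
    using A by (simp add: emeasure_distr[OF meas] space_sphere_measure)
  also have "\<dots> = ennreal (real DIM('a)) * emeasure lborel (sgn -` (f -` A \<inter> ?S) \<inter> ?K)"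
    using measurable_sets[OF meas A] by (intro em) (simp add: space_sphere_measure)
  also have "sgn -` (f -` A \<inter> ?S) \<inter> ?K = f -` (sgn -` A \<inter> ?K)"
    using f by (auto simp: fsgn f0 norm_sgn orthogonal_transformation_norm)
  also have "emeasure lborel \<dots> = emeasure (distr lborel borel f) (sgn -` A \<inter> ?K)"
    using borel_measurable_orthogonal[OF f] cone by (subst emeasure_distr) auto
  also have "\<dots> = emeasure lborel (sgn -` A \<inter> ?K)"
    by (simp add: distr_lborel_orthogonal[OF f])
  also have "ennreal (real DIM('a)) * \<dots> = emeasure sphere_measure A"
    using em[OF A] by simp
  finally show "emeasure (distr sphere_measure sphere_measure f) A = emeasure sphere_measure A" .
qed simp

lemma integral_sphere_measure_orthogonal:
  fixes f :: "'a::euclidean_space \<Rightarrow> 'a" and h :: "'a \<Rightarrow> real"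
  assumes f: "orthogonal_transformation f" and h: "h \<in> borel_measurable borel"
  shows "(LINT x|sphere_measure. h (f x)) = (LINT x|sphere_measure. h x)"
proof -
  have h': "h \<in> borel_measurable sphere_measure"
    using measurable_restrict_space1[OF h]
    by (subst measurable_cong_sets[OF sets_sphere_measure refl])
  have "(LINT x|sphere_measure. h x) = (LINT x|distr sphere_measure sphere_measure f. h x)"
    by (simp add: distr_sphere_measure_orthogonal[OF f])
  also have "\<dots> = (LINT x|sphere_measure. h (f x))"
    by (rule integral_distr[OF measurable_orthogonal_sphere_measure[OF f] h'])
  finally show ?thesis ..
qed

section \<open>Orthogonal maps act transitively on pairs with given inner product\<close>

lemma orthogonal_transformation_reflection:
  fixes u :: "'a::real_inner"
  assumes "u \<noteq> 0"
  shows "orthogonal_transformation (\<lambda>z. z - (2 * (z \<bullet> u) / (u \<bullet> u)) *\<^sub>R u)"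
  unfolding orthogonal_transformation_def
proof (intro conjI allI)
  show "linear (\<lambda>z. z - (2 * (z \<bullet> u) / (u \<bullet> u)) *\<^sub>R u)"
    by (rule linearI) (auto simp: algebra_simps add_divide_distrib)
  fix v w
  show "(v - (2 * (v \<bullet> u) / (u \<bullet> u)) *\<^sub>R u) \<bullet> (w - (2 * (w \<bullet> u) / (u \<bullet> u)) *\<^sub>R u) = v \<bullet> w"
    using assms by (simp add: inner_diff_left inner_diff_right inner_commute[of u w])
qed

text \<open>
  After moving \<open>x\<close> to \<open>x'\<close> by some orthogonal \<open>g\<close>, the vectors \<open>g y\<close> and \<open>y'\<close> have equal norms and
  equal inner products with \<open>x'\<close>. The reflection along \<open>g y - y'\<close> therefore exchanges them and
  fixes \<open>x'\<close>.
\<close>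

lemma orthogonal_transformation_pair_exists:
  fixes x y x' y' :: "real ^ 'n"
  assumes "norm x = norm x'" "norm y = norm y'" "x \<bullet> y = x' \<bullet> y'"
  obtains f where "orthogonal_transformation f" "f x = x'" "f y = y'"
proof -
  obtain g where g: "orthogonal_transformation g" "g x = x'"
    using orthogonal_transformation_exists[OF assms(1)] .
  define u where "u = g y - y'"
  have xg: "x' \<bullet> g y = x' \<bullet> y'"
    using g assms(3) by (metis orthogonal_transformation_def)
  have gg: "g y \<bullet> g y = y' \<bullet> y'"
    using g(1) assms(2) by (metis orthogonal_transformation_def norm_eq)
  show thesis
  proof (cases "u = 0")
    case True
    with g show ?thesis by (intro that[of g]) (auto simp: u_def)
  next
    case False
    define r where "r = (\<lambda>z. z - (2 * (z \<bullet> u) / (u \<bullet> u)) *\<^sub>R u)"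
    have "r x' = x'" using xg by (simp add: r_def u_def inner_diff_right)
    moreover have "2 * (g y \<bullet> u) = u \<bullet> u"
      using gg by (simp add: u_def inner_diff_right inner_diff_left inner_commute)
    hence "r (g y) = y'" using False by (simp add: r_def) (simp add: u_def)
    moreover have "orthogonal_transformation (r \<circ> g)"
      unfolding r_def by (intro orthogonal_transformation_compose orthogonal_transformation_reflection g False)
    ultimately show ?thesis using g by (intro that[of "r \<circ> g"]) auto
  qed
qed

section \<open>Polynomial functions of bounded degree\<close>

text \<open>
  The predicate speaks of functions, so that closure properties replace arithmetic with formal
  polynomials.
\<close>

definition polynomial_function_le :: "nat \<Rightarrow> (real ^ 'n::finite \<Rightarrow> real) \<Rightarrow> bool" where
  "polynomial_function_le d h \<longleftrightarrow> (\<exists>p. mpoly_degree_le p d \<and> mpoly_eval p = h)"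

lemma mpoly_eval_superset:
  assumes "finite S" "Poly_Mapping.keys p \<subseteq> S"
  shows "mpoly_eval p x = (\<Sum>m\<in>S. Poly_Mapping.lookup p m * (\<Prod>i\<in>UNIV. (x $ i) ^ Poly_Mapping.lookup m i))"
  unfolding mpoly_eval_def
proof (rule sum.mono_neutral_left[OF assms])
  show "\<forall>m\<in>S - Poly_Mapping.keys p. Poly_Mapping.lookup p m * (\<Prod>i\<in>UNIV. (x $ i) ^ Poly_Mapping.lookup m i) = 0"
    by (simp add: in_keys_iff)
qed

lemma mpoly_eval_add: "mpoly_eval (p + q) x = mpoly_eval p x + mpoly_eval q x"
proof -
  let ?S = "Poly_Mapping.keys p \<union> Poly_Mapping.keys q"
  have S: "finite ?S" "Poly_Mapping.keys p \<subseteq> ?S" "Poly_Mapping.keys q \<subseteq> ?S"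
    "Poly_Mapping.keys (p + q) \<subseteq> ?S"
    using keys_add[of p q] by auto
  show ?thesis
    by (simp only: mpoly_eval_superset[OF S(1,2)] mpoly_eval_superset[OF S(1,3)]
          mpoly_eval_superset[OF S(1,4)] lookup_add distrib_right sum.distrib)
qed

lemma polynomial_function_le_add:
  assumes "polynomial_function_le d g" "polynomial_function_le d h"
  shows "polynomial_function_le d (\<lambda>x. g x + h x)"
proof -
  obtain p q where pq: "mpoly_degree_le p d" "mpoly_eval p = g" "mpoly_degree_le q d" "mpoly_eval q = h"
    using assms by (auto simp: polynomial_function_le_def)
  have "mpoly_degree_le (p + q) d"
    using pq(1,3) keys_add[of p q] by (auto simp: mpoly_degree_le_def)
  moreover have "mpoly_eval (p + q) = (\<lambda>x. g x + h x)"
    using pq(2,4) by (auto simp: mpoly_eval_add)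
  ultimately show ?thesis by (auto simp: polynomial_function_le_def)
qed

lemma polynomial_function_le_monomial:
  assumes "(\<Sum>i\<in>UNIV. Poly_Mapping.lookup m i) \<le> d"
  shows "polynomial_function_le d (\<lambda>x. c * (\<Prod>i\<in>UNIV. (x $ i) ^ Poly_Mapping.lookup m i))"
  unfolding polynomial_function_le_def
  using assms by (intro exI[of _ "Poly_Mapping.single m c"]) (auto simp: mpoly_degree_le_def mpoly_eval_def fun_eq_iff)

lemma polynomial_function_le_const: "polynomial_function_le d (\<lambda>x. c)"
  using polynomial_function_le_monomial[of 0 d c] by simp

lemma polynomial_function_le_sum:
  assumes "\<And>i. i \<in> I \<Longrightarrow> polynomial_function_le d (h i)"
  shows "polynomial_function_le d (\<lambda>x. \<Sum>i\<in>I. h i x)"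
  using assms
  by (induction I rule: infinite_finite_induct)
     (auto intro: polynomial_function_le_const polynomial_function_le_add)

lemma polynomial_function_le_mono:
  assumes "polynomial_function_le d h" "d \<le> e"
  shows "polynomial_function_le e h"
proof -
  obtain p where "mpoly_degree_le p d" "mpoly_eval p = h"
    using assms(1) by (auto simp: polynomial_function_le_def)
  moreover from this(1) assms(2) have "mpoly_degree_le p e"
    by (fastforce simp: mpoly_degree_le_def)
  ultimately show ?thesis by (auto simp: polynomial_function_le_def)
qed

lemma polynomial_function_le_cmult:
  assumes "polynomial_function_le d h"
  shows "polynomial_function_le d (\<lambda>x. c * h x)"
proof -
  obtain p where p: "mpoly_degree_le p d" "mpoly_eval p = h"
    using assms by (auto simp: polynomial_function_le_def)
  have "polynomial_function_le d (\<lambda>x. \<Sum>m\<in>Poly_Mapping.keys p.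
      (c * Poly_Mapping.lookup p m) * (\<Prod>i\<in>UNIV. (x $ i) ^ Poly_Mapping.lookup m i))"
    using p(1) by (intro polynomial_function_le_sum polynomial_function_le_monomial)
      (auto simp: mpoly_degree_le_def)
  also have "(\<lambda>x. \<Sum>m\<in>Poly_Mapping.keys p.
      (c * Poly_Mapping.lookup p m) * (\<Prod>i\<in>UNIV. (x $ i) ^ Poly_Mapping.lookup m i)) =
      (\<lambda>x. c * h x)"
    by (simp only: p(2)[symmetric] mpoly_eval_def sum_distrib_left mult_ac)
  finally show ?thesis .
qed

lemma polynomial_function_le_mult_coordinate:
  assumes "polynomial_function_le d h"
  shows "polynomial_function_le (Suc d) (\<lambda>x. c * x $ k * h x)"
proof -
  obtain p where p: "mpoly_degree_le p d" "mpoly_eval p = h"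
    using assms by (auto simp: polynomial_function_le_def)
  let ?e = "\<lambda>m. m + Poly_Mapping.single k (1::nat)"
  have mono: "(\<Prod>i\<in>UNIV. (x $ i) ^ Poly_Mapping.lookup (?e m) i) =
      x $ k * (\<Prod>i\<in>UNIV. (x $ i) ^ Poly_Mapping.lookup m i)" for x :: "real ^ 'a" and m
  proof -
    have "(\<Prod>i\<in>UNIV. (x $ i) ^ Poly_Mapping.lookup (Poly_Mapping.single k (1::nat)) i) =
        (\<Prod>i\<in>UNIV. if i = k then x $ i else 1)"
      by (intro prod.cong) (auto simp: lookup_single)
    thus ?thesis by (simp add: lookup_add power_add prod.distrib)
  qed
  have deg: "(\<Sum>i\<in>UNIV. Poly_Mapping.lookup (?e m) i) \<le> Suc d" if "m \<in> Poly_Mapping.keys p" for m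
    using p(1) that by (auto simp: mpoly_degree_le_def lookup_add lookup_single sum.distrib when_def)
  have "polynomial_function_le (Suc d) (\<lambda>x. \<Sum>m\<in>Poly_Mapping.keys p.
      (c * Poly_Mapping.lookup p m) * (\<Prod>i\<in>UNIV. (x $ i) ^ Poly_Mapping.lookup (?e m) i))"
    by (intro polynomial_function_le_sum polynomial_function_le_monomial deg)
  also have "(\<lambda>x. \<Sum>m\<in>Poly_Mapping.keys p.
      (c * Poly_Mapping.lookup p m) * (\<Prod>i\<in>UNIV. (x $ i) ^ Poly_Mapping.lookup (?e m) i)) =
      (\<lambda>x. c * x $ k * h x)"
    by (simp only: p(2)[symmetric] mpoly_eval_def mono sum_distrib_left mult_ac)
  finally show ?thesis .
qed

lemma polynomial_function_le_mult_affine: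
  assumes "polynomial_function_le d h"
  shows "polynomial_function_le (Suc d) (\<lambda>z. (a \<bullet> z - c) * h z)"
proof -
  have "polynomial_function_le (Suc d) (\<lambda>z. (\<Sum>i\<in>UNIV. a $ i * z $ i * h z) + (- c) * h z)"
    using polynomial_function_le_mono[OF polynomial_function_le_cmult[OF assms], of "Suc d" "- c"]
    by (intro polynomial_function_le_add polynomial_function_le_sum
        polynomial_function_le_mult_coordinate assms) auto
  also have "(\<lambda>z. (\<Sum>i\<in>UNIV. a $ i * z $ i * h z) + (- c) * h z) = (\<lambda>z. (a \<bullet> z - c) * h z)"
    by (simp add: inner_vec_def left_diff_distrib sum_distrib_right)
  finally show ?thesis .
qed

lemma polynomial_function_le_prod_affine:
  assumes "finite B" "polynomial_function_le d h"
  shows "polynomial_function_le (card B + d) (\<lambda>z. (\<Prod>c\<in>B. a \<bullet> z - c) * h z)"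
  using assms(1)
proof induction
  case (insert c B)
  from polynomial_function_le_mult_affine[OF insert.IH, of a c] insert.hyps
  show ?case by (simp add: mult.assoc)
qed (use assms(2) in simp)

section \<open>Sums over spherical designs\<close>

lemma spherical_design_average:
  fixes X :: "(real ^ 'n::finite) set"
  assumes "spherical_design t X" "polynomial_function_le t h"
  shows "(\<Sum>x\<in>X. h x) / real (card X) =
           (LINT x|sphere_measure. h x) / measure sphere_measure (sphere (0 :: real ^ 'n) 1)"
  using assms unfolding spherical_design_def polynomial_function_le_def by blast

text \<open>
  Applying \<open>f\<close> to \<open>x\<close> and \<open>y\<close> alone does not change the sum, although \<open>f\<close> need not map \<open>X\<close> to
  itself: the sum is a multiple of an integral over the sphere, where the substitution of \<open>f z\<close> for
  \<open>z\<close> is allowed.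
\<close>

lemma spherical_design_zonal_sum:
  fixes X :: "(real ^ 'n::finite) set"
  assumes design: "spherical_design t X" and fin: "finite B" "finite C"
    and deg: "card B + card C \<le> t" and f: "orthogonal_transformation f"
  shows "(\<Sum>z\<in>X. (\<Prod>b\<in>B. f x \<bullet> z - b) * (\<Prod>c\<in>C. f y \<bullet> z - c)) =
         (\<Sum>z\<in>X. (\<Prod>b\<in>B. x \<bullet> z - b) * (\<Prod>c\<in>C. y \<bullet> z - c))"
proof -
  let ?h = "\<lambda>x y z :: real ^ 'n. (\<Prod>b\<in>B. x \<bullet> z - b) * (\<Prod>c\<in>C. y \<bullet> z - c)"
  have pol: "polynomial_function_le t (?h x y)" for x y
    using polynomial_function_le_prod_affine[OF fin(1)
        polynomial_function_le_prod_affine[OF fin(2) polynomial_function_le_const[of 0 1], of y], of x]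
    by (auto intro: polynomial_function_le_mono[OF _ deg])
  have "finite X" "X \<noteq> {}" using design by (auto simp: spherical_design_def)
  hence card: "real (card X) \<noteq> 0" by simp
  have "?h (f x) (f y) \<in> borel_measurable borel"
    by (intro borel_measurable_continuous_onI continuous_intros)
  from integral_sphere_measure_orthogonal[OF f this]
  have "(LINT z|sphere_measure. ?h (f x) (f y) z) = (LINT z|sphere_measure. ?h x y z)"
    using f by (simp add: orthogonal_transformation_def)
  hence "(\<Sum>z\<in>X. ?h (f x) (f y) z) / real (card X) = (\<Sum>z\<in>X. ?h x y z) / real (card X)"
    by (simp only: spherical_design_average[OF design pol])
  thus ?thesis using card by simp
qed

section \<open>Intersection numbers of antipodal designs\<close>

lemma inner_eq_1_iff_unit:
  fixes x z :: "'a::real_inner"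
  assumes "norm x = 1" "norm z = 1"
  shows "x \<bullet> z = 1 \<longleftrightarrow> z = x"
proof
  assume xz: "x \<bullet> z = 1"
  have "(z - x) \<bullet> (z - x) = 0"
    using assms xz by (simp add: inner_diff_left inner_diff_right inner_commute norm_eq_1)
  thus "z = x" by simp
qed (use assms in \<open>simp add: norm_eq_1\<close>)

lemma inner_eq_minus_1_iff_unit:
  fixes x z :: "'a::real_inner"
  assumes "norm x = 1" "norm z = 1"
  shows "x \<bullet> z = -1 \<longleftrightarrow> z = - x"
  using inner_eq_1_iff_unit[of "- x" z] assms by auto

text \<open>
  The factors \<open>x \<bullet> z - b\<close> with \<open>b\<close> in \<open>A - {u}\<close>, and likewise for \<open>y\<close> and \<open>v\<close>, form a polynomial
  in \<open>z\<close> that singles out the points to be counted among all points of \<open>X\<close> whose inner products with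
  \<open>x\<close> and \<open>y\<close> lie in \<open>A\<close>. Leaving out \<open>1\<close> and \<open>-1\<close> as roots keeps the degree low, at the price of
  correction terms from \<open>x, - x, y, - y\<close>.
\<close>

lemma card_inner_interior_orthogonal:
  fixes X :: "(real ^ 'n::finite) set"
  assumes design: "spherical_design t X" and antipodal: "antipodal X"
    and A: "finite A" "1 \<notin> A" "-1 \<notin> A"
    and dist: "\<And>x z. x \<in> X \<Longrightarrow> z \<in> X \<Longrightarrow> z \<noteq> x \<Longrightarrow> z \<noteq> - x \<Longrightarrow> x \<bullet> z \<in> A"
    and deg: "2 * (card A - 1) \<le> t"
    and uv: "u \<in> A" "v \<in> A"
    and f: "orthogonal_transformation f"
    and xy: "x \<in> X" "y \<in> X" "f x \<in> X" "f y \<in> X"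
  shows "card {z \<in> X. f x \<bullet> z = u \<and> z \<bullet> f y = v} = card {z \<in> X. x \<bullet> z = u \<and> z \<bullet> y = v}"
proof -
  define h where
    "h x y z = (\<Prod>b\<in>A - {u}. x \<bullet> z - b) * (\<Prod>c\<in>A - {v}. y \<bullet> z - c)" for x y z :: "real ^ 'n"
  define E where "E x y = {x, - x, y, - y}" for x y :: "real ^ 'n"
  define L where "L = (\<Prod>b\<in>A - {u}. u - b) * (\<Prod>c\<in>A - {v}. v - c)"
  have L: "L \<noteq> 0" using A(1) by (auto simp: L_def)
  have X: "finite X" "\<And>x. x \<in> X \<Longrightarrow> norm x = 1"
    using design by (auto simp: spherical_design_def)
  have split: "(\<Sum>z\<in>X. h x y z) =
      (\<Sum>z\<in>E x y. h x y z) + L * real (card {z \<in> X. x \<bullet> z = u \<and> z \<bullet> y = v})"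
    if x: "x \<in> X" and y: "y \<in> X" for x y
  proof -
    let ?N = "{z \<in> X. x \<bullet> z = u \<and> z \<bullet> y = v}"
    have E: "E x y \<subseteq> X" using antipodal x y by (auto simp: E_def antipodal_def)
    have N: "?N \<subseteq> X - E x y"
    proof
      fix z assume "z \<in> ?N"
      hence z: "z \<in> X" "x \<bullet> z \<in> A" "y \<bullet> z \<in> A" using uv by (auto simp: inner_commute)
      have "x \<bullet> z \<noteq> 1" "x \<bullet> z \<noteq> -1" "y \<bullet> z \<noteq> 1" "y \<bullet> z \<noteq> -1"
        using z(2,3) A(2,3) by auto
      thus "z \<in> X - E x y"
        using z(1) X(2) x y by (auto simp: E_def inner_eq_1_iff_unit inner_eq_minus_1_iff_unit)
    qed
    have hz: "h x y z = (if z \<in> ?N then L else 0)" if z: "z \<in> X - E x y" for z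
    proof -
      have "x \<bullet> z \<in> A" "y \<bullet> z \<in> A"
        using dist[of x z] dist[of y z] z x y by (auto simp: E_def)
      thus ?thesis
        using z A(1) by (auto simp: h_def L_def inner_commute[of z])
    qed
    have "(\<Sum>z\<in>X. h x y z) = (\<Sum>z\<in>X - E x y. h x y z) + (\<Sum>z\<in>E x y. h x y z)"
      by (rule sum.subset_diff[OF E X(1)])
    also have "(\<Sum>z\<in>X - E x y. h x y z) = (\<Sum>z\<in>X - E x y. if z \<in> ?N then L else 0)"
      using hz by (intro sum.cong) auto
    also have "\<dots> = (\<Sum>z\<in>(X - E x y) \<inter> ?N. L)"
      using X(1) by (subst sum.inter_restrict) auto
    also have "(X - E x y) \<inter> ?N = ?N" using N by blast
    finally show ?thesis by (simp add: mult.commute)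
  qed
  have fh: "h (f x) (f y) (f z) = h x y z" for z
    using f by (simp add: h_def orthogonal_transformation_def)
  \<comment> \<open>Some of the four points coincide when \<open>y\<close> is \<open>x\<close> or \<open>- x\<close>; reindexing the set along the
    injective \<open>f\<close> covers this without a case distinction.\<close>
  have "E (f x) (f y) = f ` E x y"
    using f by (simp add: E_def linear_neg orthogonal_transformation_linear)
  hence "(\<Sum>z\<in>E (f x) (f y). h (f x) (f y) z) = (\<Sum>z\<in>E x y. h x y z)"
    using orthogonal_transformation_inj[OF f]
    by (simp add: sum.reindex inj_on_subset fh)
  moreover have "(\<Sum>z\<in>X. h (f x) (f y) z) = (\<Sum>z\<in>X. h x y z)"
    unfolding h_def
    by (rule spherical_design_zonal_sum[OF design _ _ _ f]) (use A(1) uv deg in auto)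
  ultimately show ?thesis
    using split[of x y] split[of "f x" "f y"] xy L by simp
qed

text \<open>
  The bound \<open>2 * s - 4\<close> is the degree of the separating polynomial for \<open>s - 1\<close> interior inner products.
  An index \<open>1\<close> or \<open>-1\<close> leaves a single candidate for \<open>z\<close>, which antipodality places in \<open>X\<close>.
\<close>

lemma card_inner_eq_if_inner_eq:
  fixes X :: "(real ^ 'n::finite) set"
  assumes design: "spherical_design t X" and distance: "distance_set s X"
    and antipodal: "antipodal X" and bound: "int t \<ge> 2 * int s - 4"
    and uv: "u \<in> insert 1 (inner_products X)" "v \<in> insert 1 (inner_products X)"
    and xy: "x \<in> X" "y \<in> X" "x' \<in> X" "y' \<in> X" "x \<bullet> y = x' \<bullet> y'"
  shows "card {z \<in> X. x' \<bullet> z = u \<and> z \<bullet> y' = v} = card {z \<in> X. x \<bullet> z = u \<and> z \<bullet> y = v}"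
proof -
  let ?N = "\<lambda>x y. {z \<in> X. x \<bullet> z = u \<and> z \<bullet> y = v}"
  have X: "norm x = 1" "- x \<in> X" if "x \<in> X" for x
    using design antipodal that by (auto simp: spherical_design_def antipodal_def)
  consider "u = 1" | "u = -1" | "v = 1" | "v = -1" | "u \<notin> {1, -1}" "v \<notin> {1, -1}" by auto
  thus ?thesis
  proof cases
    case 1
    have "?N x y = (if x \<bullet> y = v then {x} else {})" if "x \<in> X" for x y
      using that X 1 by (auto simp: inner_eq_1_iff_unit)
    thus ?thesis using xy by simp
  next
    case 2
    have "?N x y = (if - (x \<bullet> y) = v then {- x} else {})" if "x \<in> X" for x y
      using that X 2 by (auto simp: inner_eq_minus_1_iff_unit norm_eq_1)
    thus ?thesis using xy by simp
  next
    case 3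
    have "?N x y = (if x \<bullet> y = u then {y} else {})" if "y \<in> X" for x y
    proof -
      have "z \<bullet> y = 1 \<longleftrightarrow> z = y" if "z \<in> X" for z
        using inner_eq_1_iff_unit[of z y] X(1) that \<open>y \<in> X\<close> by auto
      thus ?thesis using that 3 by auto
    qed
    thus ?thesis using xy by simp
  next
    case 4
    have "?N x y = (if - (x \<bullet> y) = u then {- y} else {})" if "y \<in> X" for x y
    proof -
      have "z \<bullet> y = -1 \<longleftrightarrow> z = - y" if "z \<in> X" for z
        using inner_eq_minus_1_iff_unit[of z y] X(1) that \<open>y \<in> X\<close> by auto
      thus ?thesis using that X(2) 4 by auto
    qed
    thus ?thesis using xy by simp
  next
    case 5
    define A where "A = inner_products X - {-1}"
    have fin: "finite (inner_products X)" and card: "card (inner_products X) = s"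
      using distance by (auto simp: distance_set_def)
    have "x \<bullet> x = 1" "x \<bullet> - x = -1" using X(1)[OF xy(1)] by (auto simp: norm_eq_1)
    moreover from this have "x \<noteq> - x" by (metis one_neq_neg_one)
    ultimately have "-1 \<in> inner_products X"
      unfolding inner_products_def using X(2)[OF xy(1)] xy(1)
      by (intro CollectI exI[of _ x] exI[of _ "- x"]) auto
    \<comment> \<open>Excluding \<open>-1\<close> is what brings the degree down to \<open>2 * (s - 2)\<close>.\<close>
    hence cardA: "card A = s - 1" using fin card by (simp add: A_def)
    have uvA: "u \<in> A" "v \<in> A" using 5 uv by (auto simp: A_def)
    obtain f where f: "orthogonal_transformation f" "f x = x'" "f y = y'"
      using orthogonal_transformation_pair_exists[of x x' y y'] xy X(1) by metis
    have "card (?N (f x) (f y)) = card (?N x y)"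
    proof (rule card_inner_interior_orthogonal[OF design antipodal _ _ _ _ _ uvA f(1)])
      show "1 \<notin> A" using X(1) by (auto simp: A_def inner_products_def inner_eq_1_iff_unit)
      show "x \<bullet> z \<in> A" if "x \<in> X" "z \<in> X" "z \<noteq> x" "z \<noteq> - x" for x z
        using that X(1) inner_eq_minus_1_iff_unit[of x z] by (auto simp: A_def inner_products_def)
      show "2 * (card A - 1) \<le> t" using bound cardA by linarith
    qed (use fin xy f in \<open>auto simp: A_def\<close>)
    thus ?thesis using f by simp
  qed
qed

theorem theorem1p1:
  fixes X :: "(real ^ 'n::finite) set" and s t :: nat and \<alpha> :: "nat \<Rightarrow> real"
    and R :: "nat \<Rightarrow> ((real ^ 'n) \<times> (real ^ 'n)) set"
  assumes design: "spherical_design t X"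
    and distance: "distance_set s X"
    and antipodal: "antipodal X"
    and bound: "int t \<ge> 2 * int s - 3"
    and alpha_0: "\<alpha> 0 = 1"
    and alpha: "bij_betw \<alpha> {1..s} (inner_products X)"
    and R: "\<And>i. i \<le> s \<Longrightarrow> R i = {(x, y) \<in> X \<times> X. x \<bullet> y = \<alpha> i}"
  shows "symmetric_association_scheme s X R"
proof -
  have X: "finite X" "X \<noteq> {}" "\<And>x. x \<in> X \<Longrightarrow> norm x = 1"
    using design by (auto simp: spherical_design_def)
  have one: "1 \<notin> inner_products X"
    using X(3) by (auto simp: inner_products_def inner_eq_1_iff_unit)
  have "{0..s} = insert 0 {1..s}" by auto
  hence bij: "bij_betw \<alpha> {0..s} (insert 1 (inner_products X))"
    using alpha one alpha_0 bij_betw_combine[of \<alpha> "{0}" "{1}" "{1..s}" "inner_products X"] by simp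
  have inner: "x \<bullet> y \<in> insert 1 (inner_products X)" if "x \<in> X" "y \<in> X" for x y
    using that X(3) by (auto simp: inner_products_def norm_eq_1)
  have attained: "\<exists>x\<in>X. \<exists>y\<in>X. x \<bullet> y = a" if "a \<in> insert 1 (inner_products X)" for a
    using that X(2,3) by (auto simp: inner_products_def norm_eq_1)
  show ?thesis
    unfolding symmetric_association_scheme_def
  proof (intro conjI ballI)
    show "(\<Union>i\<in>{0..s}. R i) = X \<times> X"
    proof (intro equalityI subsetI)
      fix p assume "p \<in> X \<times> X"
      moreover obtain x y where p: "p = (x, y)" by fastforce
      ultimately have xy: "x \<in> X" "y \<in> X" by auto
      then obtain i where "i \<in> {0..s}" "\<alpha> i = x \<bullet> y"
        using inner bij unfolding bij_betw_def by (metis imageE)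
      thus "p \<in> (\<Union>i\<in>{0..s}. R i)" using p xy R by (intro UN_I[of i]) auto
    qed (use R in auto)
    show "disjoint_family_on R {0..s}"
      using bij_betw_imp_inj_on[OF bij] R by (auto simp: disjoint_family_on_def inj_on_def)
    show "R i \<noteq> {}" if "i \<in> {0..s}" for i
      using attained[of "\<alpha> i"] bij_betwE[OF bij] that R by fastforce
    show "sym (R i)" if "i \<in> {0..s}" for i
      using R that by (auto simp: sym_def inner_commute)
    show "R 0 = Id_on X"
      using R[of 0] alpha_0 X(3) by (auto simp: inner_eq_1_iff_unit Id_on_def norm_eq_1)
    fix i j k assume ijk: "i \<in> {0..s}" "j \<in> {0..s}" "k \<in> {0..s}"
    let ?c = "\<lambda>x y. card {z \<in> X. (x, z) \<in> R i \<and> (z, y) \<in> R j}"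
    have c: "?c x y = card {z \<in> X. x \<bullet> z = \<alpha> i \<and> z \<bullet> y = \<alpha> j}" if "x \<in> X" "y \<in> X" for x y
      using that ijk R by (intro arg_cong[of _ _ card]) auto
    obtain x0 y0 where xy0: "x0 \<in> X" "y0 \<in> X" "x0 \<bullet> y0 = \<alpha> k"
      using attained[of "\<alpha> k"] bij_betwE[OF bij] ijk by blast
    have "?c x y = ?c x0 y0" if "(x, y) \<in> R k" for x y
    proof -
      have xy: "x \<in> X" "y \<in> X" "x \<bullet> y = \<alpha> k" using that R ijk by auto
      show ?thesis
        unfolding c[OF xy(1,2)] c[OF xy0(1,2)]
        using bij_betwE[OF bij] ijk bound xy xy0
        by (intro card_inner_eq_if_inner_eq[OF design distance antipodal]) auto
    qed
    thus "\<exists>p. \<forall>(x, y)\<in>R k. ?c x y = p" by blast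
  qed (use X in auto)
qed

end
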